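(* Let $V$ be a simple Euclidean Jordan algebra with associated symmetric cone $\Omega$, and let $d$ be the Hilbert projective metric on $\Omega$. If $x,y\in\Omega$, then $$d(x,y)=\log\frac{\lambda_M(x,y)}{\lambda_m(x,y)}=\log\bigl(\lambda_M(x,y)\,\lambda_M(y,x)\bigr).$$
   Context: A Euclidean Jordan algebra is a finite-dimensional real inner product space $(V,(\cdot|\cdot))$ with a bilinear product satisfying $xy=yx$, $x(x^2y)=x^2(xy)$ and $(xy|z)=(y|xz)$; it has an identity element $e$. It is simple if it has no non-trivial ideal. Its symmetric cone $\Omega$ is the interior of the set of squares $\{x^2 : x\in V\}$. A Jordan frame is a complete system $\{c_1,\dots,c_r\}$ of non-zero orthogonal primitive idempotents: $c_i^2=c_i$, each $c_i$ is indecomposable (not a sum of two non-zero orthogonal idempotents), $c_ic_j=0$ for $i\neq j$, and $c_1+\dots+c_r=e$, where $r$ is the rank of $V$. Every $x\in V$ can be written $x=\sum_{j=1}^r\lambda_jc_j$ for some Jordan frame and real numbers $\lambda_j$ (the eigenvalues of $x$, determined by $x$ with multiplicity); $x\in\Omega$ if and only if all $\lambda_j>0$. For such $x\in\Omega$ and $p\in\mathbb{R}$, $x^p:=\sum_j\lambda_j^pc_j$. Let $L(x)y=xy$ and let $P(x)=2L(x)^2-L(x^2)$ be the quadratic representation. For $x,y\in\Omega$, $\lambda_M(x,y)>0$ and $\lambda_m(x,y)>0$ denote the greatest and the least eigenvalue of the element $P(y^{-1/2})x\in\Omega$. Write $x\preccurlyeq y$ if $y-x\in\overline{\Omega}$.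 The Hilbert projective metric on $\Omega$ is defined by $d(x,y)=\log\frac{M(x,y)}{m(x,y)}$, where $M(x,y)=\inf\{\lambda\in\mathbb{R} : x\preccurlyeq\lambda y\}$ and $m(x,y)=\sup\{\mu\in\mathbb{R} : \mu y\preccurlyeq x\}$. *)

theory Defs
  imports "HOL-Analysis.Analysis"
begin

text \<open>
  The underlying finite-dimensional real inner product space is a type of class
  \<^class>\<open>euclidean_space\<close>; \<open>\<bullet>\<close> is the inner product of the Jordan algebra.
  The Jordan product \<open>jp\<close> and the identity element \<open>e\<close> are explicit parameters.
\<close>

locale euclidean_jordan_algebra =
  fixes jp :: "'a::euclidean_space \<Rightarrow> 'a \<Rightarrow> 'a" and e :: 'a
  assumes bilinear_jp: "bilinear jp"
    and jp_commute: "jp x y = jp y x"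
    and jordan_identity: "jp x (jp (jp x x) y) = jp (jp x x) (jp x y)"
    and inner_jp: "jp x y \<bullet> z = y \<bullet> jp x z"
    and jp_identity: "jp e x = x"

definition jordan_ideal :: "('a::euclidean_space \<Rightarrow> 'a \<Rightarrow> 'a) \<Rightarrow> 'a set \<Rightarrow> bool" where
  "jordan_ideal jp I \<longleftrightarrow> subspace I \<and> (\<forall>x. \<forall>y\<in>I. jp x y \<in> I)"

locale simple_euclidean_jordan_algebra = euclidean_jordan_algebra +
  assumes simple: "jordan_ideal jp I \<Longrightarrow> I = {0} \<or> I = UNIV"

definition symmetric_cone :: "('a::euclidean_space \<Rightarrow> 'a \<Rightarrow> 'a) \<Rightarrow> 'a set" where
  "symmetric_cone jp = interior {jp x x | x. True}"

definition idempotent :: "('a::euclidean_space \<Rightarrow> 'a \<Rightarrow> 'a) \<Rightarrow> 'a \<Rightarrow> bool" where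
  "idempotent jp c \<longleftrightarrow> jp c c = c"

definition primitive_idempotent :: "('a::euclidean_space \<Rightarrow> 'a \<Rightarrow> 'a) \<Rightarrow> 'a \<Rightarrow> bool" where
  "primitive_idempotent jp c \<longleftrightarrow> idempotent jp c \<and> c \<noteq> 0 \<and>
     \<not> (\<exists>a b. idempotent jp a \<and> a \<noteq> 0 \<and> idempotent jp b \<and> b \<noteq> 0 \<and> jp a b = 0 \<and> c = a + b)"

text \<open>
  A Jordan frame is represented by the set of its members: non-zero orthogonal idempotents are
  automatically distinct. The number of members is not prescribed; the rank of the algebra is
  the common cardinality of all its Jordan frames.
\<close>

definition jordan_frame :: "('a::euclidean_space \<Rightarrow> 'a \<Rightarrow> 'a) \<Rightarrow> 'a \<Rightarrow> 'a set \<Rightarrow> bool" where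
  "jordan_frame jp e C \<longleftrightarrow> finite C \<and> (\<forall>c\<in>C. primitive_idempotent jp c) \<and>
     (\<forall>c\<in>C. \<forall>d\<in>C. c \<noteq> d \<longrightarrow> jp c d = 0) \<and> (\<Sum>c\<in>C. c) = e"

definition spectral_decomposition ::
    "('a::euclidean_space \<Rightarrow> 'a \<Rightarrow> 'a) \<Rightarrow> 'a \<Rightarrow> 'a \<Rightarrow> 'a set \<Rightarrow> ('a \<Rightarrow> real) \<Rightarrow> bool" where
  "spectral_decomposition jp e x C l \<longleftrightarrow> jordan_frame jp e C \<and> x = (\<Sum>c\<in>C. l c *\<^sub>R c)"

text \<open>Multiplicities are dropped: only the greatest and the least eigenvalue are used.\<close>

definition eigenvalues :: "('a::euclidean_space \<Rightarrow> 'a \<Rightarrow> 'a) \<Rightarrow> 'a \<Rightarrow> 'a \<Rightarrow> real set" where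
  "eigenvalues jp e x = {l c | C l c. spectral_decomposition jp e x C l \<and> c \<in> C}"

text \<open>The real power \<open>x\<^sup>p\<close>, meaningful only for \<open>x\<close> in the symmetric cone, where all
  eigenvalues are positive and the result does not depend on the chosen decomposition.\<close>

definition jordan_powr :: "('a::euclidean_space \<Rightarrow> 'a \<Rightarrow> 'a) \<Rightarrow> 'a \<Rightarrow> 'a \<Rightarrow> real \<Rightarrow> 'a" where
  "jordan_powr jp e x p =
     (THE z. \<exists>C l. spectral_decomposition jp e x C l \<and> z = (\<Sum>c\<in>C. (l c powr p) *\<^sub>R c))"

text \<open>\<open>P(x) = 2 L(x)\<^sup>2 - L(x\<^sup>2)\<close> with \<open>L(x) y = x y\<close>.\<close>

definition quadratic_rep :: "('a::euclidean_space \<Rightarrow> 'a \<Rightarrow> 'a) \<Rightarrow> 'a \<Rightarrow> 'a \<Rightarrow> 'a" where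
  "quadratic_rep jp x = (\<lambda>z. 2 *\<^sub>R jp x (jp x z) - jp (jp x x) z)"

definition lambda_M :: "('a::euclidean_space \<Rightarrow> 'a \<Rightarrow> 'a) \<Rightarrow> 'a \<Rightarrow> 'a \<Rightarrow> 'a \<Rightarrow> real" where
  "lambda_M jp e x y = Max (eigenvalues jp e (quadratic_rep jp (jordan_powr jp e y (-1/2)) x))"

definition lambda_m :: "('a::euclidean_space \<Rightarrow> 'a \<Rightarrow> 'a) \<Rightarrow> 'a \<Rightarrow> 'a \<Rightarrow> 'a \<Rightarrow> real" where
  "lambda_m jp e x y = Min (eigenvalues jp e (quadratic_rep jp (jordan_powr jp e y (-1/2)) x))"

definition cone_le :: "('a::euclidean_space \<Rightarrow> 'a \<Rightarrow> 'a) \<Rightarrow> 'a \<Rightarrow> 'a \<Rightarrow> bool" where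
  "cone_le jp x y \<longleftrightarrow> y - x \<in> closure (symmetric_cone jp)"

definition hilbert_M :: "('a::euclidean_space \<Rightarrow> 'a \<Rightarrow> 'a) \<Rightarrow> 'a \<Rightarrow> 'a \<Rightarrow> real" where
  "hilbert_M jp x y = Inf {t::real. cone_le jp x (t *\<^sub>R y)}"

definition hilbert_m :: "('a::euclidean_space \<Rightarrow> 'a \<Rightarrow> 'a) \<Rightarrow> 'a \<Rightarrow> 'a \<Rightarrow> real" where
  "hilbert_m jp x y = Sup {t::real. cone_le jp (t *\<^sub>R y) x}"

definition hilbert_metric :: "('a::euclidean_space \<Rightarrow> 'a \<Rightarrow> 'a) \<Rightarrow> 'a \<Rightarrow> 'a \<Rightarrow> real" where
  "hilbert_metric jp x y = ln (hilbert_M jp x y / hilbert_m jp x y)"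

end

theory Submission
  imports Defs
begin

text \<open>
  An invertible \<open>P(g)\<close>, \<open>g = y\<^sup>-\<^sup>1\<^sup>/\<^sup>2\<close>, is an automorphism of the closed cone of squares with
  \<open>P(g) y = e\<close>, so \<open>x \<preceq> t y\<close> is equivalent to \<open>P(g) x \<preceq> t e\<close>, that is, to
  \<open>\<lambda>\<^sub>M(x, y) \<le> t\<close>; likewise for \<open>\<lambda>\<^sub>m\<close>. Swapping \<open>x\<close> and \<open>y\<close> inverts \<open>t\<close>, whence
  \<open>\<lambda>\<^sub>M(y, x) = 1 / \<lambda>\<^sub>m(x, y)\<close>.

  That \<open>P(g)\<close> preserves the cone is obtained without the fundamental formula: for \<open>g = exp a\<close>, the
  curve \<open>P(exp (t a)) z\<close> solves \<open>u' = 2 a u\<close>, and this flow cannot leave the cone, because for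
  squares \<open>v\<close>, \<open>c\<close> the condition \<open>v \<bullet> c = 0\<close> forces \<open>v c = 0\<close>. The spectral theorem comes from
  eigenvectors of the self-adjoint map \<open>L(x)\<close> on the span of the powers of \<open>x\<close>, where the square of
  an eigenvector is a multiple of it.
\<close>

text \<open>A maximiser of the Rayleigh quotient on the unit sphere of \<open>T\<close> is an
  eigenvector: otherwise moving it along the residual \<open>q = A v - l v\<close> would increase
  the quotient.\<close>

lemma self_adjoint_eigenvector:
  fixes A :: "'b::euclidean_space \<Rightarrow> 'b"
  assumes A: "linear A" and sym: "\<And>x y. A x \<bullet> y = x \<bullet> A y"
    and T: "subspace T" "\<And>v. v \<in> T \<Longrightarrow> A v \<in> T" and nz: "u \<in> T" "u \<noteq> 0"
  obtains v r where "v \<in> T" "v \<noteq> 0" "A v = r *\<^sub>R v"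
proof -
  have "compact (T \<inter> sphere 0 1)"
    using closed_subspace[OF T(1)] by (metis closed_Int_compact compact_sphere)
  moreover have "u /\<^sub>R norm u \<in> T \<inter> sphere 0 1"
    using nz by (simp add: subspace_scale[OF T(1)])
  then have "T \<inter> sphere 0 1 \<noteq> {}"
    by blast
  moreover have "continuous_on (T \<inter> sphere 0 1) (\<lambda>v. A v \<bullet> v)"
    using A by (intro continuous_intros linear_continuous_on) (simp add: linear_conv_bounded_linear)
  ultimately obtain v where v: "v \<in> T" "norm v = 1"
    and max: "\<And>w. w \<in> T \<Longrightarrow> norm w = 1 \<Longrightarrow> A w \<bullet> w \<le> A v \<bullet> v"
    using continuous_attains_sup[of "T \<inter> sphere 0 1" "\<lambda>v. A v \<bullet> v"]
    by (metis Int_iff mem_sphere_0)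
  define l where "l = A v \<bullet> v"
  have nonneg: "0 \<le> l * (w \<bullet> w) - A w \<bullet> w" if "w \<in> T" for w
  proof (cases "w = 0")
    case False
    then have "A (w /\<^sub>R norm w) \<bullet> (w /\<^sub>R norm w) \<le> l"
      unfolding l_def using that by (intro max) (simp_all add: subspace_scale[OF T(1)])
    then show ?thesis
      using False by (simp add: linear_scale[OF A] field_simps dot_square_norm power2_eq_square)
  qed (use linear_0[OF A] in simp)
  define q where "q = A v - l *\<^sub>R v"
  have qT: "q \<in> T"
    unfolding q_def using v T by (simp add: subspace_diff subspace_scale)
  define N where "N = l * (q \<bullet> q) - A q \<bullet> q"
  have vv: "v \<bullet> v = 1"
    using v by (simp add: dot_square_norm)
  \<comment> \<open>The form \<open>l * (w \<bullet> w) - A w \<bullet> w\<close> is nonnegative on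
    \<open>T\<close> and vanishes at \<open>v\<close>; this is its value at
    \<open>v + s *\<^sub>R q\<close>.\<close>
  have "0 \<le> - 2 * s * (q \<bullet> q) + s\<^sup>2 * N" for s
  proof -
    have "v + s *\<^sub>R q \<in> T"
      using v qT T(1) by (simp add: subspace_add subspace_scale)
    then have "0 \<le> l * ((v + s *\<^sub>R q) \<bullet> (v + s *\<^sub>R q)) - A (v + s *\<^sub>R q) \<bullet> (v + s *\<^sub>R q)"
      by (rule nonneg)
    also have "\<dots> = l * (v \<bullet> v) - A v \<bullet> v - 2 * s * ((A v - l *\<^sub>R v) \<bullet> q) + s\<^sup>2 * N"
      using sym[of q v] unfolding N_def
      by (simp add: linear_add[OF A] linear_scale[OF A] inner_commute algebra_simps power2_eq_square)
    finally show ?thesis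
      using vv by (simp add: l_def q_def)
  qed
  note quad = this
  have "q \<bullet> q \<le> 0"
  proof (rule ccontr)
    assume "\<not> q \<bullet> q \<le> 0"
    then have pos: "q \<bullet> q > 0" by (simp only: not_le)
    \<comment> \<open>Small enough for the negative linear term to dominate
      \<open>s\<^sup>2 * N\<close>; adding 1 keeps the denominator positive.\<close>
    define s where "s = (q \<bullet> q) / (\<bar>N\<bar> + 1)"
    have "\<bar>N\<bar> + 1 > 0"
      by linarith
    then have s: "s > 0" "s * (\<bar>N\<bar> + 1) = q \<bullet> q"
      using pos by (simp_all only: s_def zero_less_divide_iff) auto
    have "s * N \<le> s * (\<bar>N\<bar> + 1)"
      using s by (intro mult_left_mono) auto
    then have "- 2 * (q \<bullet> q) + s * N < 0"
      using s(2) pos by linarith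
    then have "s * (- 2 * (q \<bullet> q) + s * N) < 0"
      using s(1) by (simp add: mult_pos_neg)
    with quad[of s] show False
      by (simp add: algebra_simps power2_eq_square)
  qed
  then have "q = 0"
    using inner_gt_zero_iff not_le by blast
  then have "A v = l *\<^sub>R v"
    by (simp add: q_def)
  moreover have "v \<noteq> 0"
    using v by auto
  ultimately show ?thesis
    using v that by blast
qed

section \<open>Bilinearity rules and the polarized Jordan identity\<close>

context euclidean_jordan_algebra
begin

lemma jp_add_left: "jp (x + y) z = jp x z + jp y z"
  and jp_add_right: "jp x (y + z) = jp x y + jp x z"
  and jp_scaleR_left: "jp (r *\<^sub>R x) y = r *\<^sub>R jp x y"
  and jp_scaleR_right: "jp x (r *\<^sub>R y) = r *\<^sub>R jp x y"
  and jp_minus_left: "jp (- x) y = - jp x y"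
  and jp_minus_right: "jp x (- y) = - jp x y"
  and jp_diff_left: "jp (x - y) z = jp x z - jp y z"
  and jp_diff_right: "jp x (y - z) = jp x y - jp x z"
  and jp_zero_left: "jp 0 y = 0"
  and jp_zero_right: "jp x 0 = 0"
  by (fact bilinear_ladd[OF bilinear_jp] bilinear_radd[OF bilinear_jp]
      bilinear_lmul[OF bilinear_jp] bilinear_rmul[OF bilinear_jp]
      bilinear_lneg[OF bilinear_jp] bilinear_rneg[OF bilinear_jp]
      bilinear_lsub[OF bilinear_jp] bilinear_rsub[OF bilinear_jp]
      bilinear_lzero[OF bilinear_jp] bilinear_rzero[OF bilinear_jp])+

lemmas jp_bilinear = jp_add_left jp_add_right jp_scaleR_left jp_scaleR_right
  jp_minus_left jp_minus_right jp_diff_left jp_diff_right jp_zero_left jp_zero_right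

lemma linear_jp: "linear (jp x)"
  using bilinear_jp by (simp add: bilinear_def)

lemma linear_jp_left: "linear (\<lambda>y. jp y x)"
  using bilinear_jp by (simp add: bilinear_def)

lemma jp_sum_left: "jp (\<Sum>i\<in>I. f i) y = (\<Sum>i\<in>I. jp (f i) y)"
  using linear_sum[OF linear_jp_left] .

lemma jp_sum_right: "jp x (\<Sum>i\<in>I. f i) = (\<Sum>i\<in>I. jp x (f i))"
  using linear_sum[OF linear_jp] .

lemma jp_identity_right: "jp x e = x"
  by (metis jp_commute jp_identity)

lemma inner_square_identity: "jp z z \<bullet> e = z \<bullet> z"
  by (simp add: inner_jp jp_identity_right)

lemma inner_idempotent_identity: "idempotent jp c \<Longrightarrow> c \<bullet> e = c \<bullet> c"
  using inner_square_identity[of c] by (simp add: idempotent_def)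

text \<open>Each side \<open>f\<close> of the Jordan identity is cubic in its first argument, so
  \<open>f (x + z) - f (x - z) - 2 *\<^sub>R f z\<close> isolates twice the part linear in
  \<open>z\<close>.\<close>

lemma jordan_identity_polarized:
  "2 *\<^sub>R jp x (jp (jp x z) y) + jp z (jp (jp x x) y)
   = 2 *\<^sub>R jp (jp x z) (jp x y) + jp (jp x x) (jp z y)"
proof -
  have p: "jp (x + z) (jp (jp (x + z) (x + z)) y) - jp (x - z) (jp (jp (x - z) (x - z)) y)
        - 2 *\<^sub>R jp z (jp (jp z z) y)
      = 2 *\<^sub>R (2 *\<^sub>R jp x (jp (jp x z) y) + jp z (jp (jp x x) y))"
    by (simp add: jp_bilinear jp_commute[of z x] algebra_simps scaleR_2)
  have q: "jp (jp (x + z) (x + z)) (jp (x + z) y) - jp (jp (x - z) (x - z)) (jp (x - z) y)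
        - 2 *\<^sub>R jp (jp z z) (jp z y)
      = 2 *\<^sub>R (2 *\<^sub>R jp (jp x z) (jp x y) + jp (jp x x) (jp z y))"
    by (simp add: jp_bilinear jp_commute[of z x] algebra_simps scaleR_2)
  show ?thesis
    using p q by (simp add: jordan_identity)
qed

text \<open>Commutativity turns the polarized identity into a relation between multiplication
  operators acting on \<open>z\<close>, which expresses \<open>L(x^2 y)\<close> through
  multiplications by simpler elements.\<close>

lemma jordan_identity_operator:
  "2 *\<^sub>R jp x (jp y (jp x z)) + jp (jp (jp x x) y) z
   = 2 *\<^sub>R jp (jp x y) (jp x z) + jp (jp x x) (jp y z)"
  using jordan_identity_polarized[of x z y]
  by (metis jp_commute)

subsection \<open>Powers of an element\<close>

text \<open>The product is not associative, so the bracketing is fixed by iterating left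
  multiplication.\<close>

definition jpow :: "'a \<Rightarrow> nat \<Rightarrow> 'a" where
  "jpow x n = (jp x ^^ n) e"

lemma jpow_0: "jpow x 0 = e"
  and jpow_Suc: "jpow x (Suc n) = jp x (jpow x n)"
  by (simp_all add: jpow_def)

lemma jpow_1: "jpow x (Suc 0) = x"
  by (simp add: jpow_0 jpow_Suc jp_identity_right)

lemma jp_square_jpow: "jp (jp x x) (jpow x n) = jpow x (Suc (Suc n))"
proof (induction n)
  case 0
  then show ?case by (simp add: jpow_0 jpow_Suc jp_identity_right)
next
  case (Suc n)
  then show ?case
    by (metis jordan_identity jpow_Suc)
qed

text \<open>The operator identity with \<open>y = x^n\<close> writes \<open>L(x^(n+2))\<close> in
  terms of \<open>L(x^(n+1))\<close>, \<open>L(x^n)\<close>, \<open>L(x)\<close> and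
  \<open>L(x^2)\<close>. These commute with \<open>L(x)\<close> by the two induction hypotheses and
  the Jordan identity.\<close>

lemma jpow_commute: "jp (jpow x n) (jp x z) = jp x (jp (jpow x n) z)"
proof (induction n arbitrary: z rule: induct_nat_012)
  case 0
  then show ?case by (simp add: jpow_0 jp_identity)
next
  case 1
  then show ?case by (simp add: jpow_1)
next
  case (ge2 n)
  have *: "jp (jpow x (Suc (Suc n))) z = 2 *\<^sub>R jp (jpow x (Suc n)) (jp x z)
      + jp (jp x x) (jp (jpow x n) z) - 2 *\<^sub>R jp x (jp (jpow x n) (jp x z))" for z
    using jordan_identity_operator[of x "jpow x n" z]
    by (simp add: jp_square_jpow jpow_Suc[symmetric] algebra_simps)
  show ?case
    by (simp add: * ge2 jp_bilinear jordan_identity)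
qed

definition jpow_span :: "'a \<Rightarrow> 'a set" where
  "jpow_span x = span (range (jpow x))"

lemma subspace_jpow_span: "subspace (jpow_span x)"
  by (simp add: jpow_span_def)

lemma identity_in_jpow_span: "e \<in> jpow_span x"
  unfolding jpow_span_def by (metis jpow_0 rangeI span_base)

lemma jpow_span_commute:
  assumes "v \<in> jpow_span x"
  shows "jp v (jp x z) = jp x (jp v z)"
  using assms unfolding jpow_span_def
proof (induction rule: span_induct_alt)
  case (step a u v)
  then show ?case by (auto simp: jp_bilinear jpow_commute)
qed (simp add: jp_bilinear)

lemma jp_in_jpow_span:
  assumes "v \<in> jpow_span x"
  shows "jp x v \<in> jpow_span x"
proof -
  have "jp x ` range (jpow x) \<subseteq> range (jpow x)"
    by (auto simp: jpow_Suc[symmetric])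
  then show ?thesis
    using assms linear_span_image[OF linear_jp, of x "range (jpow x)"] span_mono
    unfolding jpow_span_def by blast
qed

text \<open>As \<open>w\<close> is a polynomial in \<open>x\<close>, \<open>L(w)\<close> commutes
  with \<open>L(x)\<close>, so a factor \<open>x\<close> can be pulled out of
  \<open>x^(n+1) w\<close>.\<close>

lemma jpow_eigenvector:
  assumes w: "w \<in> jpow_span x" and eig: "jp x w = r *\<^sub>R w"
  shows "jp (jpow x n) w = (r ^ n) *\<^sub>R w"
proof (induction n)
  case 0
  then show ?case by (simp add: jpow_0 jp_identity)
next
  case (Suc n)
  have "jp (jpow x (Suc n)) w = jp w (jp x (jpow x n))"
    by (metis jp_commute jpow_Suc)
  also have "\<dots> = jp x (jp (jpow x n) w)"
    by (metis jpow_span_commute[OF w] jp_commute)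
  finally show ?case
    by (simp add: Suc jp_bilinear eig)
qed

text \<open>With \<open>v = w\<close> this makes the square of an eigenvector in the span of the
  powers proportional to the eigenvector, hence an idempotent up to scaling.\<close>

lemma jpow_span_eigenvector:
  assumes v: "v \<in> jpow_span x" and w: "w \<in> jpow_span x" and eig: "jp x w = r *\<^sub>R w"
  obtains s where "jp v w = s *\<^sub>R w"
proof -
  have "\<exists>s. jp v w = s *\<^sub>R w"
    using v unfolding jpow_span_def
  proof (induction rule: span_induct_alt)
    case base
    then show ?case by (metis jp_zero_left scaleR_zero_left)
  next
    case (step a u v)
    then obtain n s where "u = jpow x n" "jp v w = s *\<^sub>R w" by blast
    then have "jp (a *\<^sub>R u + v) w = (a * r ^ n + s) *\<^sub>R w"
      by (simp add: jp_bilinear jpow_eigenvector[OF w eig] scaleR_add_left)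
    then show ?case by blast
  qed
  then show ?thesis using that by blast
qed

subsection \<open>Idempotents and the spectral theorem\<close>

lemma idempotentD: "idempotent jp c \<Longrightarrow> jp c c = c"
  by (simp add: idempotent_def)

text \<open>The operator identity at \<open>x = y = c\<close> yields the Peirce polynomial
  \<open>t (2 t - 1) (t - 1)\<close>, which annihilates \<open>L(c)\<close>.\<close>

lemma idempotent_cubic:
  assumes "idempotent jp c"
  shows "2 *\<^sub>R jp c (jp c (jp c z)) = 3 *\<^sub>R jp c (jp c z) - jp c z"
proof -
  have "2 *\<^sub>R jp c (jp c (jp c z)) + jp c z = 2 *\<^sub>R jp c (jp c z) + jp c (jp c z)"
    using jordan_identity_operator[of c c z] by (simp add: idempotentD[OF assms])
  also have "\<dots> = 3 *\<^sub>R jp c (jp c z)"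
    using scaleR_add_left[of 2 1 "jp c (jp c z)"] by simp
  finally show ?thesis by (simp add: algebra_simps)
qed

text \<open>\<open>L(c)\<close> has eigenvalues in \<open>{0, 1/2, 1}\<close>, and there \<open>t = t\<^sup>2 + 4 (t - t\<^sup>2)\<^sup>2\<close>.\<close>

lemma inner_jp_idempotent:
  assumes "idempotent jp c"
  shows "jp c z \<bullet> z = jp c z \<bullet> jp c z
    + 4 * ((jp c z - jp c (jp c z)) \<bullet> (jp c z - jp c (jp c z)))"
proof -
  define A where "A = jp c"
  have sym: "A u \<bullet> v = u \<bullet> A v" for u v
    unfolding A_def by (metis inner_jp)
  have 2: "A z \<bullet> A z = z \<bullet> A (A z)" and 3: "A z \<bullet> A (A z) = z \<bullet> A (A (A z))"
    and 4: "A (A z) \<bullet> A (A z) = z \<bullet> A (A (A (A z)))"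
    by (simp_all add: sym)
  have cub: "2 *\<^sub>R A (A (A w)) = 3 *\<^sub>R A (A w) - A w" for w
    unfolding A_def by (rule idempotent_cubic[OF assms])
  have c3: "2 * (z \<bullet> A (A (A z))) = 3 * (z \<bullet> A (A z)) - z \<bullet> A z"
    and c4: "2 * (z \<bullet> A (A (A (A z)))) = 3 * (z \<bullet> A (A (A z))) - z \<bullet> A (A z)"
    using arg_cong[OF cub[of z], of "\<lambda>v. z \<bullet> v"] arg_cong[OF cub[of "A z"], of "\<lambda>v. z \<bullet> v"]
    by (simp_all add: inner_diff_right)
  have "A z \<bullet> z = A z \<bullet> A z + 4 * (A z \<bullet> A z - 2 * (A z \<bullet> A (A z)) + A (A z) \<bullet> A (A z))"
    using 2 3 4 c3 c4 sym[of z z] by argo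
  then have "A z \<bullet> z = A z \<bullet> A z + 4 * ((A z - A (A z)) \<bullet> (A z - A (A z)))"
    by (simp add: inner_diff_left inner_diff_right inner_commute[of "A (A z)" "A z"])
  then show ?thesis by (simp add: A_def)
qed

lemma inner_jp_idempotent_nonneg: "idempotent jp c \<Longrightarrow> 0 \<le> jp c z \<bullet> z"
  by (simp add: inner_jp_idempotent)

lemma inner_idempotent_square: "c \<bullet> jp z z = jp c z \<bullet> z"
  by (metis inner_commute inner_jp jp_commute)

lemma inner_idempotent_square_nonneg: "idempotent jp c \<Longrightarrow> 0 \<le> c \<bullet> jp z z"
  by (simp add: inner_idempotent_square inner_jp_idempotent_nonneg)

text \<open>The number \<open>c \<bullet> jp z z\<close> equals \<open>jp c z \<bullet> z\<close>, a
  sum of nonnegative terms one of which is the squared norm of \<open>jp c z\<close>.\<close>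

lemma jp_idempotent_eq_0:
  assumes "idempotent jp c" "c \<bullet> jp z z = 0"
  shows "jp c z = 0"
proof -
  have "jp c z \<bullet> jp c z + 4 * ((jp c z - jp c (jp c z)) \<bullet> (jp c z - jp c (jp c z))) = 0"
    using assms inner_jp_idempotent[of c z] by (simp add: inner_idempotent_square)
  then show ?thesis
    by (metis add_nonneg_eq_0_iff inner_eq_zero_iff inner_ge_zero mult_nonneg_nonneg
        zero_le_numeral)
qed

lemma jp_idempotents_eq_0:
  assumes "idempotent jp c" "idempotent jp d" "c \<bullet> d = 0"
  shows "jp c d = 0"
  using jp_idempotent_eq_0[of c d] assms by (simp add: idempotentD)

lemma inner_idempotents_nonneg:
  "idempotent jp c \<Longrightarrow> idempotent jp d \<Longrightarrow> 0 \<le> c \<bullet> d"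
  using inner_idempotent_square_nonneg[of c d] by (simp add: idempotentD)

lemma inner_idempotents_eq_0:
  assumes "idempotent jp c" "jp c d = 0"
  shows "c \<bullet> d = 0"
  by (metis assms idempotentD inner_jp inner_zero_right)

text \<open>A Jordan frame without primitivity and completeness, so that it can be extended or
  refined one idempotent at a time.\<close>

definition orthogonal_idempotents :: "'a set \<Rightarrow> bool" where
  "orthogonal_idempotents C \<longleftrightarrow> finite C \<and> (\<forall>c\<in>C. idempotent jp c \<and> c \<noteq> 0) \<and>
     (\<forall>c\<in>C. \<forall>d\<in>C. c \<noteq> d \<longrightarrow> jp c d = 0)"

lemma orthogonal_idempotents_card_le:
  assumes "orthogonal_idempotents C"
  shows "card C \<le> DIM('a)"
proof -
  have "pairwise orthogonal C"
    using assms inner_idempotents_eq_0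
    unfolding orthogonal_idempotents_def pairwise_def orthogonal_def by blast
  moreover have "0 \<notin> C"
    using assms unfolding orthogonal_idempotents_def by blast
  ultimately have "independent C"
    by (rule pairwise_orthogonal_independent)
  then show ?thesis
    using independent_bound by blast
qed

text \<open>Orthogonality bounds the size by the dimension, so a family of greatest size exists; the
  extension and refinement arguments below contradict its maximality.\<close>

lemma orthogonal_idempotents_maximal:
  assumes "P C0" "\<And>C. P C \<Longrightarrow> orthogonal_idempotents C"
  obtains C where "P C" "\<And>D. P D \<Longrightarrow> card D \<le> card C"
proof -
  have "\<forall>C. P C \<longrightarrow> card C \<le> DIM('a)"
    using assms(2) orthogonal_idempotents_card_le by blast
  then have "\<exists>C. P C \<and> (\<forall>D. P D \<longrightarrow> card D \<le> card C)"
    using ex_has_greatest_nat[of P C0 card "Suc DIM('a)"] assms(1) by (simp add: less_Suc_eq_le)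
  then show ?thesis
    using that by blast
qed

lemma jp_orthogonal_idempotents_sum:
  assumes "orthogonal_idempotents C" "c \<in> C"
  shows "jp c (\<Sum>d\<in>C. l d *\<^sub>R d) = l c *\<^sub>R c"
proof -
  have "jp c (\<Sum>d\<in>C. l d *\<^sub>R d) = (\<Sum>d\<in>C. if d = c then l c *\<^sub>R c else 0)"
    unfolding jp_sum_right
    using assms by (intro sum.cong) (auto simp: jp_bilinear orthogonal_idempotents_def idempotentD)
  then show ?thesis
    using assms by (simp add: orthogonal_idempotents_def)
qed

lemma jp_orthogonal_idempotents_sum_1:
  assumes "orthogonal_idempotents C" "c \<in> C"
  shows "jp c (\<Sum>C) = c"
  using jp_orthogonal_idempotents_sum[OF assms, of "\<lambda>_. 1"] by simp

text \<open>Take a largest such family inside the span of the powers of \<open>x\<close>. If its sum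
  is not \<open>e\<close>, the difference is a non-zero element of the common annihilator
  \<open>T\<close>. There \<open>L(x)\<close> has an eigenvector, and rescaling it gives one more
  idempotent.\<close>

lemma complete_eigen_idempotents:
  obtains C where "orthogonal_idempotents C" "\<Sum>C = e" "\<And>c. c \<in> C \<Longrightarrow> \<exists>r. jp x c = r *\<^sub>R c"
proof -
  define P where "P C \<longleftrightarrow> orthogonal_idempotents C \<and> C \<subseteq> jpow_span x \<and>
      (\<forall>c\<in>C. \<exists>r. jp x c = r *\<^sub>R c)" for C
  have "P {}"
    by (simp add: P_def orthogonal_idempotents_def)
  then obtain C where C: "P C" and max: "\<And>D. P D \<Longrightarrow> card D \<le> card C"
    using orthogonal_idempotents_maximal[of P "{}"] unfolding P_def by blast
  note C' = C[unfolded P_def]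
  have "\<Sum>C = e"
  proof (rule ccontr)
    assume ne: "\<Sum>C \<noteq> e"
    define T where "T = {v \<in> jpow_span x. \<forall>d\<in>C. jp d v = 0}"
    have subT: "subspace T"
      using subspace_jpow_span[of x]
      unfolding T_def subspace_def by (auto simp: jp_bilinear)
    have inv: "jp x v \<in> T" if "v \<in> T" for v
      using that C' jpow_span_commute[of _ x v]
      unfolding T_def by (auto simp: jp_in_jpow_span jp_bilinear)
    have "e - \<Sum>C \<in> T"
      using C' jp_orthogonal_idempotents_sum_1[of C]
      unfolding T_def
      by (auto simp: jp_bilinear jp_identity_right subspace_diff subspace_sum subset_iff
          subspace_jpow_span identity_in_jpow_span)
    then obtain v r where v: "v \<in> T" "v \<noteq> 0" "jp x v = r *\<^sub>R v"
      using self_adjoint_eigenvector[OF linear_jp, of x T "e - \<Sum>C"] subT inv ne inner_jp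
      by (metis eq_iff_diff_eq_0)
    then obtain s where s: "jp v v = s *\<^sub>R v"
      using jpow_span_eigenvector[of v x v r] unfolding T_def by blast
    \<comment> \<open>Otherwise \<open>v \<bullet> v = jp v v \<bullet> e\<close> would
      vanish.\<close>
    have "s \<noteq> 0"
      using s v(2) inner_square_identity[of v] by auto
    define c where "c = v /\<^sub>R s"
    have c: "c \<in> T" "c \<noteq> 0" "jp c c = c" "jp x c = r *\<^sub>R c"
      using v s \<open>s \<noteq> 0\<close> by (simp_all add: c_def subspace_scale[OF subT] jp_bilinear)
    then have "c \<notin> C"
      unfolding T_def by auto
    have "jp c d = 0 \<and> jp d c = 0" if "d \<in> C" for d
      using that c(1) jp_commute[of c d] by (simp add: T_def)
    then have "P (insert c C)"
      using c C' unfolding P_def T_def orthogonal_idempotents_def idempotent_def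
      by blast
    from max[OF this] \<open>c \<notin> C\<close> C' show False
      by (simp add: orthogonal_idempotents_def)
  qed
  then show ?thesis
    using C' that by blast
qed

lemma jordan_frame_orthogonal_idempotents:
  "jordan_frame jp e C \<Longrightarrow> orthogonal_idempotents C"
  by (simp add: jordan_frame_def orthogonal_idempotents_def primitive_idempotent_def)

text \<open>Among the complete families of eigen-idempotents of \<open>L(x)\<close> take one of
  greatest size. If a member were a sum of two orthogonal non-zero idempotents, replacing it by the
  two parts would give a larger family, so all members are primitive.\<close>

lemma spectral_decomposition_exists:
  obtains C l where "spectral_decomposition jp e x C l"
proof -
  \<comment> \<open>Membership in the span of the powers of \<open>x\<close> is dropped here, since
    the parts of a split idempotent may leave it.\<close>
  define P where "P C \<longleftrightarrow> orthogonal_idempotents C \<and> \<Sum>C = e \<and>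
      (\<forall>c\<in>C. \<exists>r. jp x c = r *\<^sub>R c)" for C
  have "\<exists>C. P C"
  proof (rule complete_eigen_idempotents[of x])
    fix C
    assume "orthogonal_idempotents C" "\<Sum>C = e" "\<And>c. c \<in> C \<Longrightarrow> \<exists>r. jp x c = r *\<^sub>R c"
    then have "P C"
      by (simp add: P_def)
    then show ?thesis ..
  qed
  then obtain C0 where "P C0" ..
  moreover have "orthogonal_idempotents C" if "P C" for C
    using that by (simp add: P_def)
  ultimately obtain C where C: "P C" and max: "\<And>D. P D \<Longrightarrow> card D \<le> card C"
    using orthogonal_idempotents_maximal[of P C0] by metis
  note C' = C[unfolded P_def]
  have fin: "finite C"
    using C' by (simp add: orthogonal_idempotents_def)
  obtain l where l: "\<And>c. c \<in> C \<Longrightarrow> jp x c = l c *\<^sub>R c"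
    using C' by metis
  have "x = jp x (\<Sum>C)"
    using C' by (simp add: jp_identity_right)
  also have "\<dots> = (\<Sum>c\<in>C. l c *\<^sub>R c)"
    unfolding jp_sum_right using l by simp
  finally have x: "x = (\<Sum>c\<in>C. l c *\<^sub>R c)" .
  \<comment> \<open>The numbers \<open>a \<bullet> d\<close> and \<open>b \<bullet> d\<close> are
    nonnegative and add up to \<open>c \<bullet> d = 0\<close>, so both vanish.\<close>
  have orth: "jp a d = 0 \<and> a \<noteq> d"
    if c: "c \<in> C" and d: "d \<in> C - {c}" and ab: "idempotent jp a" "idempotent jp b" "c = a + b"
    for a b c d
  proof -
    have id: "idempotent jp d" "d \<noteq> 0" "jp c d = 0" "idempotent jp c"
      using C' c d unfolding orthogonal_idempotents_def by auto
    have "a \<bullet> d + b \<bullet> d = 0"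
      using inner_idempotents_eq_0[of c d] id ab(3) by (simp add: inner_add_left)
    then have "a \<bullet> d = 0"
      using inner_idempotents_nonneg[of a d] inner_idempotents_nonneg[of b d] ab id by linarith
    then show ?thesis
      using jp_idempotents_eq_0 ab id by auto
  qed
  have "primitive_idempotent jp c" if c: "c \<in> C" for c
    unfolding primitive_idempotent_def
  proof (intro conjI notI)
    show "idempotent jp c" "c = 0 \<Longrightarrow> False"
      using C' c unfolding orthogonal_idempotents_def by auto
    assume "\<exists>a b. idempotent jp a \<and> a \<noteq> 0 \<and> idempotent jp b \<and> b \<noteq> 0 \<and> jp a b = 0 \<and> c = a + b"
    then obtain a b where ab: "idempotent jp a" "a \<noteq> 0" "idempotent jp b" "b \<noteq> 0" "jp a b = 0"
        "c = a + b"
      by blast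
    have ne: "a \<noteq> b"
      using ab by (auto simp: idempotent_def)
    have nin: "a \<notin> C - {c}" "b \<notin> C - {c}"
      using orth[OF c _ ab(1,3,6), of a] orth[OF c _ ab(3,1), of b] ab(6) add.commute[of a b]
      by metis+
    have orth_ab: "jp a d = 0" "jp b d = 0" "jp d a = 0" "jp d b = 0" if "d \<in> C - {c}" for d
      using orth[OF c that ab(1,3,6)] orth[OF c that ab(3,1)] ab(6) jp_commute[of d]
      by (simp_all add: add.commute)
    have "jp x u = l c *\<^sub>R u" if "u \<in> {a, b}" for u
    proof -
      have "jp c u = u"
        using that ab by (auto simp: jp_bilinear idempotentD jp_commute[of b a])
      have "jp x u = (\<Sum>d\<in>C. l d *\<^sub>R jp d u)"
        by (subst x) (simp add: jp_sum_left jp_bilinear)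
      also have "\<dots> = l c *\<^sub>R jp c u + (\<Sum>d\<in>C - {c}. l d *\<^sub>R jp d u)"
        using fin c by (rule sum.remove)
      also have "(\<Sum>d\<in>C - {c}. l d *\<^sub>R jp d u) = 0"
        using orth_ab that by (intro sum.neutral) auto
      finally show ?thesis
        using \<open>jp c u = u\<close> by simp
    qed
    then have xd: "\<exists>r. jp x d = r *\<^sub>R d" if "d = a \<or> d = b \<or> d \<in> C - {c}" for d
      using that l by blast
    define D where "D = insert a (insert b (C - {c}))"
    have "orthogonal_idempotents D"
      using C' ab orth_ab jp_commute[of b a] unfolding D_def orthogonal_idempotents_def
      by auto
    moreover have "\<Sum>D = e"
    proof -
      have "\<Sum>D = a + (b + \<Sum>(C - {c}))"
        using nin ne fin by (simp add: D_def)
      also have "\<dots> = \<Sum>C"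
        using ab(6) sum.remove[OF fin c, of "\<lambda>c. c"] by simp
      finally show ?thesis
        using C' by simp
    qed
    ultimately have "P D"
      using xd unfolding P_def D_def by blast
    moreover have "card D = Suc (card C)"
      using nin ne fin c card_Suc_Diff1[OF fin c] by (simp add: D_def)
    ultimately show False
      using max[of D] by simp
  qed
  then have frame: "jordan_frame jp e C"
    using C' unfolding jordan_frame_def orthogonal_idempotents_def by blast
  show ?thesis
    using frame x that unfolding spectral_decomposition_def by blast
qed


subsection \<open>The cone of squares\<close>

lemma spectral_decompositionD:
  assumes "spectral_decomposition jp e x C l"
  shows "orthogonal_idempotents C" "\<Sum>C = e" "x = (\<Sum>c\<in>C. l c *\<^sub>R c)"
  using assms jordan_frame_orthogonal_idempotents
  unfolding spectral_decomposition_def jordan_frame_def by auto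

lemma jp_spectral_decomposition:
  assumes "spectral_decomposition jp e x C l" "c \<in> C"
  shows "jp x c = l c *\<^sub>R c"
  using jp_orthogonal_idempotents_sum[of C c l] spectral_decompositionD[OF assms(1)] assms(2)
  by (metis jp_commute)

lemma inner_spectral_decomposition:
  assumes "spectral_decomposition jp e x C l" "c \<in> C"
  shows "x \<bullet> c = l c * (c \<bullet> c)"
proof -
  have "jp c c = c"
    using spectral_decompositionD(1)[OF assms(1)] assms(2)
    by (simp add: orthogonal_idempotents_def idempotent_def)
  then have "x \<bullet> c = jp x c \<bullet> c"
    by (metis inner_jp inner_commute jp_commute)
  then show ?thesis
    by (simp add: jp_spectral_decomposition[OF assms])
qed

lemma jp_orthogonal_idempotents_sums:
  assumes "orthogonal_idempotents C"
  shows "jp (\<Sum>c\<in>C. l c *\<^sub>R c) (\<Sum>c\<in>C. m c *\<^sub>R c) = (\<Sum>c\<in>C. (l c * m c) *\<^sub>R c)"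
  unfolding jp_sum_left
  by (intro sum.cong) (simp_all add: jp_scaleR_left jp_orthogonal_idempotents_sum[OF assms])

definition squares :: "'a set" where
  "squares = {jp x x | x. True}"

text \<open>Self-duality of the cone. A square has nonnegative coefficients in a Jordan frame, and
  idempotents pair nonnegatively with squares. Conversely, testing with the frame members makes the
  eigenvalues nonnegative, so a square root exists.\<close>

lemma mem_squares_iff: "x \<in> squares \<longleftrightarrow> (\<forall>z. 0 \<le> x \<bullet> jp z z)"
proof
  assume "x \<in> squares"
  then obtain w where w: "x = jp w w"
    by (auto simp: squares_def)
  obtain C m where C: "spectral_decomposition jp e w C m"
    using spectral_decomposition_exists .
  have x: "x = (\<Sum>c\<in>C. (m c * m c) *\<^sub>R c)"
    using jp_orthogonal_idempotents_sums[of C m m] spectral_decompositionD[OF C] w by simp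
  have "0 \<le> (\<Sum>c\<in>C. (m c * m c) * (c \<bullet> jp z z))" for z
    using spectral_decompositionD(1)[OF C]
    by (intro sum_nonneg mult_nonneg_nonneg[OF zero_le_square])
      (simp add: orthogonal_idempotents_def inner_idempotent_square_nonneg)
  then show "\<forall>z. 0 \<le> x \<bullet> jp z z"
    unfolding x by (simp add: inner_sum_left)
next
  assume x: "\<forall>z. 0 \<le> x \<bullet> jp z z"
  obtain C l where C: "spectral_decomposition jp e x C l"
    using spectral_decomposition_exists .
  note D = spectral_decompositionD[OF C]
  have "0 \<le> l c" if c: "c \<in> C" for c
  proof -
    have "jp c c = c" "c \<bullet> c > 0"
      using D(1) c by (auto simp: orthogonal_idempotents_def idempotent_def)
    then have "0 \<le> l c * (c \<bullet> c)"
      using x inner_spectral_decomposition[OF C c] by metis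
    then show ?thesis
      using \<open>c \<bullet> c > 0\<close> by (simp add: zero_le_mult_iff)
  qed
  then have "x = (\<Sum>c\<in>C. (sqrt (l c) * sqrt (l c)) *\<^sub>R c)"
    using D(3) by simp
  also have "\<dots> = jp (\<Sum>c\<in>C. sqrt (l c) *\<^sub>R c) (\<Sum>c\<in>C. sqrt (l c) *\<^sub>R c)"
    using jp_orthogonal_idempotents_sums[OF D(1), of "\<lambda>c. sqrt (l c)" "\<lambda>c. sqrt (l c)"] by simp
  finally show "x \<in> squares"
    by (auto simp: squares_def)
qed

lemma mem_squares_spectral:
  assumes C: "spectral_decomposition jp e x C l"
  shows "x \<in> squares \<longleftrightarrow> (\<forall>c\<in>C. 0 \<le> l c)"
proof
  note D = spectral_decompositionD[OF C]
  have id: "jp c c = c \<and> c \<bullet> c > 0 \<and> idempotent jp c" if "c \<in> C" for c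
    using D(1) that by (auto simp: orthogonal_idempotents_def idempotent_def)
  show "\<forall>c\<in>C. 0 \<le> l c" if "x \<in> squares"
  proof
    fix c assume c: "c \<in> C"
    have "0 \<le> x \<bullet> jp c c"
      using that unfolding mem_squares_iff by blast
    then have "0 \<le> l c * (c \<bullet> c)"
      using inner_spectral_decomposition[OF C c] id[OF c] by simp
    then show "0 \<le> l c"
      using id[OF c] by (simp add: zero_le_mult_iff)
  qed
  show "x \<in> squares" if "\<forall>c\<in>C. 0 \<le> l c"
    unfolding mem_squares_iff D(3) inner_sum_left inner_scaleR_left
    using that id by (blast intro: sum_nonneg mult_nonneg_nonneg inner_idempotent_square_nonneg)
qed

lemma squares_eq_Inter: "squares = (\<Inter>z. {x. jp z z \<bullet> x \<ge> 0})"
  by (auto simp: mem_squares_iff inner_commute)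

lemma closed_squares: "closed squares"
  unfolding squares_eq_Inter by (intro closed_INT ballI closed_halfspace_ge)

lemma convex_squares: "convex squares"
  unfolding squares_eq_Inter by (intro convex_INT convex_halfspace_ge)

lemma squares_scaleR: "0 \<le> r \<Longrightarrow> x \<in> squares \<Longrightarrow> r *\<^sub>R x \<in> squares"
  by (simp add: mem_squares_iff)

lemma jp_bounded:
  obtains B where "B > 0" "\<And>x y. norm (jp x y) \<le> B * norm x * norm y"
  using bilinear_bounded_pos[OF bilinear_jp] by blast

text \<open>A lower bound \<open>\<delta>\<close> on the eigenvalues gives
  \<open>\<delta> * (z \<bullet> z) \<le> x \<bullet> jp z z\<close>, and moving \<open>x\<close> by
  less than \<open>\<delta> / B\<close> changes the right side by at most the left side.\<close>

lemma interior_squaresI: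
  assumes C: "spectral_decomposition jp e x C l" and pos: "\<And>c. c \<in> C \<Longrightarrow> 0 < l c"
  shows "x \<in> interior squares"
proof -
  note D = spectral_decompositionD[OF C]
  obtain B where B: "B > 0" "\<And>x y. norm (jp x y) \<le> B * norm x * norm y"
    using jp_bounded by blast
  have "finite C"
    using D(1) by (simp add: orthogonal_idempotents_def)
  then have "\<exists>\<delta>>0. \<forall>c\<in>C. \<delta> \<le> l c"
    using pos
  proof (induction C rule: finite_induct)
    case empty
    then show ?case by (auto intro: exI[of _ 1])
  next
    case (insert c F)
    then obtain \<delta> where "\<delta> > 0" "\<forall>c\<in>F. \<delta> \<le> l c" by auto
    then show ?case
      using insert.prems by (intro exI[of _ "min \<delta> (l c)"]) auto
  qed
  then obtain \<delta> where \<delta>: "\<delta> > 0" "\<forall>c\<in>C. \<delta> \<le> l c" by blast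
  have "ball x (\<delta> / B) \<subseteq> squares"
  proof
    fix w assume "w \<in> ball x (\<delta> / B)"
    then have w: "norm (w - x) * B \<le> \<delta>"
      using B(1) by (simp add: dist_norm norm_minus_commute field_simps)
    show "w \<in> squares"
      unfolding mem_squares_iff
    proof
      fix z
      have "\<delta> * (z \<bullet> z) = \<delta> * (e \<bullet> jp z z)"
        by (simp add: inner_square_identity inner_commute[of e])
      also have "\<dots> = (\<Sum>c\<in>C. \<delta> * (c \<bullet> jp z z))"
        by (simp add: D(2)[symmetric] inner_sum_left sum_distrib_left)
      also have "\<dots> \<le> (\<Sum>c\<in>C. l c * (c \<bullet> jp z z))"
        using \<delta> D(1) by (intro sum_mono mult_right_mono inner_idempotent_square_nonneg)
          (auto simp: orthogonal_idempotents_def)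
      also have "\<dots> = x \<bullet> jp z z"
        by (subst D(3)) (simp add: inner_sum_left)
      finally have 1: "\<delta> * (z \<bullet> z) \<le> x \<bullet> jp z z" .
      have "\<bar>(w - x) \<bullet> jp z z\<bar> \<le> norm (w - x) * norm (jp z z)"
        by (rule Cauchy_Schwarz_ineq2)
      also have "\<dots> \<le> norm (w - x) * (B * norm z * norm z)"
        by (intro mult_left_mono B) auto
      also have "\<dots> = (norm (w - x) * B) * (z \<bullet> z)"
        by (simp add: dot_square_norm power2_eq_square)
      also have "\<dots> \<le> \<delta> * (z \<bullet> z)"
        using w by (intro mult_right_mono) auto
      finally show "0 \<le> w \<bullet> jp z z"
        using 1 by (simp add: inner_diff_left)
    qed
  qed
  moreover have "\<delta> / B > 0"
    using \<delta>(1) B(1) by simp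
  ultimately show ?thesis
    unfolding mem_interior by blast
qed

lemma interior_squaresD:
  assumes "x \<in> interior squares"
  obtains \<delta> where "\<delta> > 0" "x - \<delta> *\<^sub>R y \<in> squares"
proof -
  obtain r where r: "r > 0" "ball x r \<subseteq> squares"
    using assms by (auto simp: mem_interior)
  define \<delta> where "\<delta> = r / (norm y + 1)"
  have pos: "norm y + 1 > 0"
    by (simp add: add_nonneg_pos)
  have "\<delta> > 0" "\<delta> * norm y < r"
    using r(1) pos by (simp_all add: \<delta>_def field_simps)
  then have "x - \<delta> *\<^sub>R y \<in> ball x r"
    by (simp add: dist_norm)
  then show ?thesis
    using that \<open>\<delta> > 0\<close> r(2) by blast
qed

lemma symmetric_cone_eq: "symmetric_cone jp = interior squares"
  by (simp add: symmetric_cone_def squares_def)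

text \<open>The frame sums to \<open>e\<close>, so adding a multiple of \<open>e\<close> shifts all
  coefficients alike.\<close>

lemma spectral_decomposition_affine:
  assumes "spectral_decomposition jp e x C l"
  shows "spectral_decomposition jp e (r *\<^sub>R e + s *\<^sub>R x) C (\<lambda>c. r + s * l c)"
  using assms unfolding spectral_decomposition_def jordan_frame_def
  by (auto simp: scaleR_add_left sum.distrib scaleR_sum_right)

lemma identity_in_interior_squares: "e \<in> interior squares"
proof -
  \<comment> \<open>Decomposing 0 merely supplies some Jordan frame, in which \<open>e\<close> has
    all coefficients 1.\<close>
  obtain C l where "spectral_decomposition jp e 0 C l"
    using spectral_decomposition_exists .
  from spectral_decomposition_affine[OF this, of 1 0] show ?thesis
    by (intro interior_squaresI[of e C "\<lambda>_. 1"]) auto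
qed

lemma closure_symmetric_cone: "closure (symmetric_cone jp) = squares"
  using convex_closure_interior[OF convex_squares] identity_in_interior_squares
    closure_closed[OF closed_squares] unfolding symmetric_cone_eq by blast

lemma cone_le_iff: "cone_le jp x y \<longleftrightarrow> y - x \<in> squares"
  by (simp add: cone_le_def closure_symmetric_cone)

lemma symmetric_cone_eigenvalues_pos:
  assumes "x \<in> symmetric_cone jp" and C: "spectral_decomposition jp e x C l" and "c \<in> C"
  shows "0 < l c"
proof -
  obtain \<delta> where \<delta>: "\<delta> > 0" "x - \<delta> *\<^sub>R e \<in> squares"
    using assms(1) interior_squaresD unfolding symmetric_cone_eq by blast
  then have "\<forall>c\<in>C. 0 \<le> l c - \<delta>"
    using mem_squares_spectral[OF spectral_decomposition_affine[OF C, of "- \<delta>" 1]]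
    by (simp add: algebra_simps)
  then show ?thesis
    using \<delta>(1) assms(3) by force
qed

section \<open>Independence of eigenvalues and powers from the chosen decomposition\<close>

lemma identity_nonzero: "e \<noteq> 0"
proof
  assume "e = 0"
  then have "x = 0" for x :: 'a
    using jp_identity[of x] by (simp add: jp_zero_left)
  then show False
    using nonempty_Basis nonzero_Basis by blast
qed

lemma spectral_decomposition_nonempty:
  "spectral_decomposition jp e x C l \<Longrightarrow> C \<noteq> {}"
  using spectral_decompositionD(2) identity_nonzero by fastforce

text \<open>Eigenvectors of the self-adjoint map \<open>L(x)\<close> for distinct eigenvalues are
  orthogonal.\<close>

lemma inner_spectral_decompositions:
  assumes "spectral_decomposition jp e x C l" "c \<in> C"
    and "spectral_decomposition jp e x D k" "d \<in> D"
  shows "l c = k d \<or> c \<bullet> d = 0"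
  using inner_jp[of x c d] jp_spectral_decomposition[OF assms(1,2)]
    jp_spectral_decomposition[OF assms(3,4)] by auto

lemma eigenvalues_subset:
  assumes C: "spectral_decomposition jp e x C l" and D: "spectral_decomposition jp e x D k"
  shows "k ` D \<subseteq> l ` C"
proof
  fix r assume "r \<in> k ` D"
  then obtain d where d: "d \<in> D" "r = k d" by blast
  have "idempotent jp d" "d \<noteq> 0"
    using spectral_decompositionD(1)[OF D] d(1) by (auto simp: orthogonal_idempotents_def)
  \<comment> \<open>The sum is \<open>e \<bullet> d = d \<bullet> d\<close>; hence some
    \<open>c\<close> is not orthogonal to \<open>d\<close> and shares its eigenvalue.\<close>
  then have "(\<Sum>c\<in>C. c \<bullet> d) \<noteq> 0"
    using inner_idempotent_identity[of d] spectral_decompositionD(2)[OF C]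
    by (simp add: inner_sum_left[symmetric] inner_commute)
  then obtain c where "c \<in> C" "c \<bullet> d \<noteq> 0"
    by (rule sum.not_neutral_contains_not_neutral)
  then show "r \<in> l ` C"
    using inner_spectral_decompositions[OF C _ D d(1)] d(2) by (metis imageI)
qed

lemma eigenvalues_eq:
  assumes C: "spectral_decomposition jp e x C l"
  shows "eigenvalues jp e x = l ` C"
  using C eigenvalues_subset[OF C] unfolding eigenvalues_def by blast

lemma jordan_powr_eq:
  assumes C: "spectral_decomposition jp e x C l"
  shows "jordan_powr jp e x p = (\<Sum>c\<in>C. (l c powr p) *\<^sub>R c)"
  unfolding jordan_powr_def
proof (rule the_equality)
  show "\<exists>D k. spectral_decomposition jp e x D k \<and>
      (\<Sum>c\<in>C. (l c powr p) *\<^sub>R c) = (\<Sum>c\<in>D. (k c powr p) *\<^sub>R c)"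
    using C by blast
  define u where "u C l = (\<Sum>c\<in>C. (l c powr p) *\<^sub>R c)" for C and l :: "'a \<Rightarrow> real"
  \<comment> \<open>Wherever \<open>c \<bullet> d\<close> is non-zero, \<open>l c = k d\<close>, so
    the power can be exchanged. The claim is kept general in both decompositions because it is used
    in both directions: the difference of the two candidates is orthogonal to each of them.\<close>
  have inner_u: "u C l \<bullet> d = u D k \<bullet> d"
    if C: "spectral_decomposition jp e x C l" and D: "spectral_decomposition jp e x D k"
      and d: "d \<in> D" for C l D k d
  proof -
    note D' = spectral_decompositionD[OF D]
    have "u C l \<bullet> d = (\<Sum>c\<in>C. (l c powr p) * (c \<bullet> d))"
      by (simp add: u_def inner_sum_left)
    also have "\<dots> = (\<Sum>c\<in>C. (k d powr p) * (c \<bullet> d))"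
    proof (intro sum.cong refl)
      fix c assume "c \<in> C"
      from inner_spectral_decompositions[OF C this D d]
      show "(l c powr p) * (c \<bullet> d) = (k d powr p) * (c \<bullet> d)"
        by auto
    qed
    also have "\<dots> = (k d powr p) * (e \<bullet> d)"
      using spectral_decompositionD(2)[OF C]
      by (simp add: sum_distrib_left[symmetric] inner_sum_left[symmetric])
    also have "e \<bullet> d = d \<bullet> d"
      using inner_idempotent_identity[of d] D'(1) d
      by (simp add: orthogonal_idempotents_def inner_commute)
    also have "(k d powr p) * (d \<bullet> d) = (\<Sum>c\<in>D. if c = d then (k d powr p) * (d \<bullet> d) else 0)"
      using d D'(1) by (simp add: orthogonal_idempotents_def)
    also have "\<dots> = (\<Sum>c\<in>D. (k c powr p) * (c \<bullet> d))"
      using D'(1) d inner_idempotents_eq_0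
      by (intro sum.cong) (auto simp: orthogonal_idempotents_def)
    also have "\<dots> = u D k \<bullet> d"
      by (simp add: u_def inner_sum_left)
    finally show ?thesis .
  qed
  fix z assume "\<exists>D k. spectral_decomposition jp e x D k \<and> z = (\<Sum>c\<in>D. (k c powr p) *\<^sub>R c)"
  then obtain D k where D: "spectral_decomposition jp e x D k" and z: "z = u D k"
    by (auto simp: u_def)
  have "(u C l - u D k) \<bullet> u D k = 0"
    unfolding u_def[of D k] inner_sum_right
    using inner_u[OF C D] by (simp add: inner_diff_left u_def)
  moreover have "(u C l - u D k) \<bullet> u C l = 0"
    unfolding u_def[of C l] inner_sum_right
    using inner_u[OF D C] by (simp add: inner_diff_left u_def)
  ultimately have "(u C l - u D k) \<bullet> (u C l - u D k) = 0"
    by (simp add: inner_diff_right)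
  then show "z = (\<Sum>c\<in>C. (l c powr p) *\<^sub>R c)"
    using z by (simp add: u_def)
qed

lemma mem_squares_identity_diff:
  assumes C: "spectral_decomposition jp e x C l"
  shows "t *\<^sub>R e - x \<in> squares \<longleftrightarrow> Max (eigenvalues jp e x) \<le> t"
    and "x - t *\<^sub>R e \<in> squares \<longleftrightarrow> t \<le> Min (eigenvalues jp e x)"
proof -
  have fin: "finite C"
    using spectral_decompositionD(1)[OF C] by (simp add: orthogonal_idempotents_def)
  note ne = spectral_decomposition_nonempty[OF C]
  show "t *\<^sub>R e - x \<in> squares \<longleftrightarrow> Max (eigenvalues jp e x) \<le> t"
    using mem_squares_spectral[OF spectral_decomposition_affine[OF C, of t "-1"]] fin ne
    by (simp add: eigenvalues_eq[OF C])
  show "x - t *\<^sub>R e \<in> squares \<longleftrightarrow> t \<le> Min (eigenvalues jp e x)"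
    using mem_squares_spectral[OF spectral_decomposition_affine[OF C, of "-t" 1]] fin ne
    by (simp add: eigenvalues_eq[OF C] algebra_simps)
qed


subsection \<open>Positivity of the quadratic representation\<close>

text \<open>At a first exit time of the perturbed curve \<open>v\<close> some \<open>c\<close> in a Jordan frame of \<open>v\<close> has eigenvalue
  \<open>0\<close>. Then \<open>a v \<bullet> c = a \<bullet> v c = 0\<close>, and the perturbation makes \<open>(v \<bullet> c)'\<close> strictly positive.\<close>

lemma flow_squares_perturbed:
  assumes u: "\<And>t. (u has_vector_derivative 2 *\<^sub>R jp a (u t)) (at t)"
    and u0: "u 0 \<in> squares" and "0 \<le> T" and \<epsilon>: "\<epsilon> > 0"
    and K: "\<And>c. idempotent jp c \<Longrightarrow> c \<noteq> 0 \<Longrightarrow> 0 < (K *\<^sub>R e - 2 *\<^sub>R a) \<bullet> c"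
  shows "u T + (\<epsilon> * exp (K * T)) *\<^sub>R e \<in> squares"
proof (rule ccontr)
  define v where "v t = u t + (\<epsilon> * exp (K * t)) *\<^sub>R e" for t
  assume "u T + (\<epsilon> * exp (K * T)) *\<^sub>R e \<notin> squares"
  then have vT: "v T \<notin> squares"
    by (simp add: v_def)
  \<comment> \<open>As \<open>jp a e = a\<close>, replacing \<open>u\<close> by \<open>v\<close>
    costs \<open>2 *\<^sub>R a\<close> times the perturbation; the growth rate \<open>K\<close>
    compensates for it.\<close>
  have v: "(v has_vector_derivative
      2 *\<^sub>R jp a (v t) + (\<epsilon> * exp (K * t)) *\<^sub>R (K *\<^sub>R e - 2 *\<^sub>R a)) (at t)" for t
  proof -
    have "((\<lambda>t. \<epsilon> * exp (K * t)) has_vector_derivative \<epsilon> * exp (K * t) * K) (at t)"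
      unfolding has_real_derivative_iff_has_vector_derivative[symmetric]
      by (auto intro!: derivative_eq_intros)
    then have "(v has_vector_derivative
        2 *\<^sub>R jp a (u t) + (\<epsilon> * exp (K * t) * K) *\<^sub>R e) (at t)"
      unfolding v_def
      by (intro has_vector_derivative_add u)
        (rule bounded_linear.has_vector_derivative[OF bounded_linear_scaleR_left])
    also have "2 *\<^sub>R jp a (u t) + (\<epsilon> * exp (K * t) * K) *\<^sub>R e
        = 2 *\<^sub>R jp a (v t) + (\<epsilon> * exp (K * t)) *\<^sub>R (K *\<^sub>R e - 2 *\<^sub>R a)"
      by (simp add: v_def jp_bilinear jp_identity_right scaleR_add_right scaleR_diff_right
          mult.commute mult.left_commute)
    finally show ?thesis .
  qed
  have cont: "isCont v t" for t
    using v has_vector_derivative_continuous by blast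
  \<comment> \<open>The times at which \<open>v\<close> is not interior form a compact set; its
    least element \<open>t0\<close> is the first exit time.\<close>
  define Z where "Z = {0..T} \<inter> v -` (- interior squares)"
  have "compact Z"
    unfolding Z_def using cont
    by (intro compact_Int_closed compact_Icc continuous_closed_vimage) auto
  moreover have "T \<in> Z"
    using vT \<open>0 \<le> T\<close> interior_subset by (auto simp: Z_def)
  ultimately obtain t0 where t0: "t0 \<in> Z" and min: "\<And>t. t \<in> Z \<Longrightarrow> t0 \<le> t"
    using compact_attains_inf[of Z] by blast
  have inside: "v t \<in> squares" if "0 \<le> t" "t < t0" for t
  proof -
    have "t \<notin> Z"
      using min[of t] that by auto
    then show ?thesis
      using that t0 interior_subset by (auto simp: Z_def)
  qed
  have "v 0 \<in> interior squares"
  proof -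
    obtain C l where C: "spectral_decomposition jp e (u 0) C l"
      using spectral_decomposition_exists .
    from spectral_decomposition_affine[OF C, of \<epsilon> 1]
    show ?thesis
      using mem_squares_spectral[OF C] u0 \<epsilon>
      by (intro interior_squaresI[of _ C "\<lambda>c. \<epsilon> + 1 * l c"])
        (auto simp: v_def add.commute add_pos_nonneg)
  qed
  then have "t0 > 0"
    using t0 by (cases "t0 = 0") (auto simp: Z_def)
  have vt0: "v t0 \<in> squares"
    unfolding mem_squares_iff
  proof
    fix z
    have "((\<lambda>t. v t \<bullet> jp z z) \<longlongrightarrow> v t0 \<bullet> jp z z) (at_left t0)"
      using cont[of t0] unfolding isCont_def
      by (intro tendsto_intros) (rule filterlim_mono[OF _ order_refl at_le], auto)
    moreover have "\<forall>\<^sub>F t in at_left t0. 0 \<le> v t \<bullet> jp z z"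
      using \<open>t0 > 0\<close> inside unfolding eventually_at_left[OF \<open>t0 > 0\<close>] mem_squares_iff
      by (intro exI[of _ 0]) auto
    ultimately show "0 \<le> v t0 \<bullet> jp z z"
      by (rule tendsto_lowerbound) simp
  qed
  obtain C l where C: "spectral_decomposition jp e (v t0) C l"
    using spectral_decomposition_exists .
  have "\<not> (\<forall>c\<in>C. 0 < l c)"
    using interior_squaresI[OF C] t0 by (auto simp: Z_def)
  then obtain c where c: "c \<in> C" "l c = 0"
    using mem_squares_spectral[OF C] vt0 by force
  then have vc: "jp (v t0) c = 0"
    by (simp add: jp_spectral_decomposition[OF C])
  have id: "idempotent jp c" "c \<noteq> 0"
    using spectral_decompositionD(1)[OF C] c(1) by (auto simp: orthogonal_idempotents_def)
  define D where "D = (\<epsilon> * exp (K * t0)) * ((K *\<^sub>R e - 2 *\<^sub>R a) \<bullet> c)"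
  have "jp a (v t0) \<bullet> c = 0"
    using vc by (metis inner_jp inner_zero_right jp_commute)
  then have "((\<lambda>t. v t \<bullet> c) has_real_derivative D) (at t0)"
    using bounded_linear.has_vector_derivative[OF bounded_linear_inner_left v[of t0], of c]
    unfolding has_real_derivative_iff_has_vector_derivative D_def
    by (simp add: inner_add_left)
  moreover have "D > 0"
    using \<epsilon> K[OF id] by (simp add: D_def)
  ultimately obtain d where d: "d > 0"
    and less: "\<And>h. 0 < h \<Longrightarrow> h < d \<Longrightarrow> v (t0 - h) \<bullet> c < v t0 \<bullet> c"
    using DERIV_pos_inc_left by blast
  \<comment> \<open>The function \<open>v t \<bullet> c\<close> is 0 at \<open>t0\<close> with
    positive derivative, hence negative at \<open>t0 - h\<close>, where \<open>v\<close> is still in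
    the cone. The bound by \<open>t0\<close> keeps this time nonnegative.\<close>
  define h where "h = min (d / 2) t0"
  have h: "0 < h" "h < d" "h \<le> t0"
    using d \<open>t0 > 0\<close> by (auto simp: h_def)
  have "0 \<le> v (t0 - h) \<bullet> jp c c"
    using inside[of "t0 - h"] h unfolding mem_squares_iff by simp
  moreover have "v t0 \<bullet> c = 0"
    using inner_spectral_decomposition[OF C c(1)] c(2) by simp
  ultimately show False
    using less[OF h(1,2)] idempotentD[OF id(1)] by simp
qed

text \<open>The perturbation of the previous lemma is made arbitrarily small, after fixing a
  suitable \<open>K\<close>.\<close>

lemma flow_squares:
  assumes u: "\<And>t. (u has_vector_derivative 2 *\<^sub>R jp a (u t)) (at t)"
    and u0: "u 0 \<in> squares" and T: "0 \<le> T"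
  shows "u T \<in> squares"
proof -
  obtain B where B: "B > 0" "\<And>x y. norm (jp x y) \<le> B * norm x * norm y"
    using jp_bounded by blast
  \<comment> \<open>\<open>B * norm a\<close> bounds \<open>a \<bullet> c\<close> relative to
    \<open>c \<bullet> c = e \<bullet> c\<close>; the extra 1 makes the inequality strict.\<close>
  define K where "K = 2 * (B * norm a) + 1"
  have K: "0 < (K *\<^sub>R e - 2 *\<^sub>R a) \<bullet> c" if c: "idempotent jp c" "c \<noteq> 0" for c
  proof -
    have "a \<bullet> c = jp a c \<bullet> c"
      by (metis c(1) idempotentD inner_commute inner_jp jp_commute)
    also have "\<dots> \<le> norm (jp a c) * norm c"
      by (rule norm_cauchy_schwarz)
    also have "\<dots> \<le> (B * norm a * norm c) * norm c"
      by (intro mult_right_mono B) auto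
    also have "\<dots> = (B * norm a) * (c \<bullet> c)"
      by (simp add: dot_square_norm power2_eq_square)
    finally have "2 * (a \<bullet> c) < K * (c \<bullet> c)"
      using c(2) by (simp add: K_def algebra_simps add_strict_increasing)
    then show ?thesis
      using inner_idempotent_identity[OF c(1)] by (simp add: inner_diff_left inner_commute[of e])
  qed
  show ?thesis
    unfolding mem_squares_iff
  proof
    fix z
    show "0 \<le> u T \<bullet> jp z z"
    proof (rule field_le_epsilon)
      fix r :: real assume "r > 0"
      define s where "s = r / (z \<bullet> z + 1)"
      have pos: "z \<bullet> z + 1 > 0"
        by (simp add: add_nonneg_pos)
      then have s: "s > 0" "s * (z \<bullet> z) \<le> r"
        using \<open>r > 0\<close> by (simp_all add: s_def field_simps)
      \<comment> \<open>Dividing by the growth factor leaves exactly \<open>s *\<^sub>R e\<close> at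
        time \<open>T\<close>.\<close>
      have "u T + (s / exp (K * T) * exp (K * T)) *\<^sub>R e \<in> squares"
        using s(1) by (intro flow_squares_perturbed[OF u u0 T _ K]) auto
      then have "0 \<le> u T \<bullet> jp z z + s * (z \<bullet> z)"
        unfolding mem_squares_iff
        by (simp add: inner_add_left inner_commute[of e] inner_square_identity)
      then show "0 \<le> u T \<bullet> jp z z + r"
        using s(2) by linarith
    qed
  qed
qed

section \<open>Peirce components of the quadratic representation\<close>

definition polar_rep :: "'a \<Rightarrow> 'a \<Rightarrow> 'a \<Rightarrow> 'a" where
  "polar_rep c d z = jp c (jp d z) + jp d (jp c z) - jp (jp c d) z"

text \<open>\<open>polar_rep\<close> is the polarization of \<open>P\<close>, with
  \<open>polar_rep c c\<close> equal to \<open>P(c)\<close>, so \<open>P\<close> of a linear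
  combination expands bilinearly.\<close>

lemma quadratic_rep_sum:
  "quadratic_rep jp (\<Sum>c\<in>C. g c *\<^sub>R c) z = (\<Sum>c\<in>C. \<Sum>d\<in>C. (g c * g d) *\<^sub>R polar_rep c d z)"
proof -
  define x where "x = (\<Sum>c\<in>C. g c *\<^sub>R c)"
  have x: "jp x w = (\<Sum>c\<in>C. g c *\<^sub>R jp c w)" for w
    by (simp add: x_def jp_sum_left jp_bilinear)
  \<comment> \<open>The two copies of \<open>L(x)^2\<close> are expanded in opposite orders of
    \<open>c\<close> and \<open>d\<close>, to match the first two terms of
    \<open>polar_rep\<close>.\<close>
  have 1: "jp x (jp x z) = (\<Sum>c\<in>C. \<Sum>d\<in>C. (g c * g d) *\<^sub>R jp d (jp c z))"
    by (simp add: x jp_sum_right jp_bilinear scaleR_sum_right)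
  also have "\<dots> = (\<Sum>c\<in>C. \<Sum>d\<in>C. (g c * g d) *\<^sub>R jp c (jp d z))"
    by (subst sum.swap) (simp add: mult.commute)
  finally have 2: "jp x (jp x z) = \<dots>" .
  have "jp x x = (\<Sum>c\<in>C. \<Sum>d\<in>C. (g c * g d) *\<^sub>R jp c d)"
    by (subst x) (simp add: x_def jp_sum_right jp_bilinear scaleR_sum_right)
  then have 3: "jp (jp x x) z = (\<Sum>c\<in>C. \<Sum>d\<in>C. (g c * g d) *\<^sub>R jp (jp c d) z)"
    by (simp add: jp_sum_left jp_bilinear)
  have "quadratic_rep jp x z = jp x (jp x z) + jp x (jp x z) - jp (jp x x) z"
    by (simp add: quadratic_rep_def scaleR_2)
  also have "\<dots> = (\<Sum>c\<in>C. \<Sum>d\<in>C. (g c * g d) *\<^sub>R polar_rep c d z)"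
    unfolding 3 by (subst 1, subst 2)
      (simp add: polar_rep_def scaleR_add_right scaleR_diff_right sum.distrib sum_subtractf)
  finally show ?thesis
    by (simp add: x_def)
qed

text \<open>In the polarized identity both terms containing \<open>jp c d\<close> drop out.\<close>

lemma orthogonal_idempotents_commute:
  assumes "idempotent jp c" "jp c d = 0"
  shows "jp c (jp d z) = jp d (jp c z)"
  using jordan_identity_polarized[of c d z] assms by (simp add: idempotentD jp_bilinear)

text \<open>The operator identity at \<open>c\<close>, \<open>d\<close> leaves
  \<open>2 L(c) L(d) L(c) = L(c) L(d)\<close>; commuting puts the range of \<open>L(c) L(d)\<close>
  into the 1/2-eigenspace of \<open>L(c)\<close>.\<close>

lemma orthogonal_idempotents_half:
  assumes "idempotent jp c" "jp c d = 0"
  shows "2 *\<^sub>R jp c (jp c (jp d z)) = jp c (jp d z)"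
  using jordan_identity_operator[of c d z] assms orthogonal_idempotents_commute[OF assms]
  by (simp add: idempotentD jp_bilinear)

text \<open>The idempotent \<open>b + c\<close> also annihilates \<open>d\<close>. Subtracting the
  half relations of \<open>b\<close> and of \<open>c\<close> from that of \<open>b + c\<close>
  leaves only the mixed terms, which coincide.\<close>

lemma orthogonal_idempotents_triple:
  assumes "idempotent jp b" "idempotent jp c" "jp b c = 0" "jp b d = 0" "jp c d = 0"
  shows "jp b (jp c (jp d z)) = 0"
proof -
  have "idempotent jp (b + c)"
    using assms(1-3) jp_commute[of c b] by (simp add: idempotent_def jp_bilinear)
  then have "2 *\<^sub>R jp (b + c) (jp (b + c) (jp d z)) = jp (b + c) (jp d z)"
    using assms by (intro orthogonal_idempotents_half) (auto simp: jp_bilinear)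
  then have "2 *\<^sub>R (jp b (jp c (jp d z)) + jp c (jp b (jp d z))) = 0"
    using orthogonal_idempotents_half[OF assms(1,4), of z]
      orthogonal_idempotents_half[OF assms(2,5), of z]
    by (simp add: jp_bilinear algebra_simps)
  then show ?thesis
    using orthogonal_idempotents_commute[OF assms(1,3), of "jp d z"]
    by (simp add: scaleR_2[symmetric])
qed

text \<open>The range of \<open>polar_rep c d\<close> lies in the Peirce space of the pair \<open>c, d\<close>.\<close>

lemma jp_polar_rep:
  assumes C: "orthogonal_idempotents C" and k: "k \<in> C" "c \<in> C" "d \<in> C"
  shows "jp k (polar_rep c d z) = ((if k = c then 1/2 else 0) + (if k = d then 1/2 else 0)) *\<^sub>R
    polar_rep c d z"
proof -
  have id: "idempotent jp k" "idempotent jp c" "idempotent jp d"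
    and orth: "\<And>x y. x \<in> C \<Longrightarrow> y \<in> C \<Longrightarrow> x \<noteq> y \<Longrightarrow> jp x y = 0"
    using C k by (auto simp: orthogonal_idempotents_def)
  show ?thesis
  proof (cases "c = d")
    case True
    then have p: "polar_rep c d z = 2 *\<^sub>R jp c (jp c z) - jp c z"
      using id by (simp add: polar_rep_def idempotentD scaleR_2)
    show ?thesis
    proof (cases "k = c")
      case True
      have "jp c (polar_rep c d z) = (3 *\<^sub>R jp c (jp c z) - jp c z) - jp c (jp c z)"
        unfolding p jp_diff_right jp_scaleR_right idempotent_cubic[OF id(2)] ..
      also have "\<dots> = polar_rep c d z"
        using scaleR_left_diff_distrib[of 3 1 "jp c (jp c z)"] by (simp add: p algebra_simps)
      finally show ?thesis
        using True \<open>c = d\<close> by simp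
    next
      case False
      have "2 *\<^sub>R jp c (jp c (jp k z)) = jp c (jp k z)"
        using orth[of c k] k False by (intro orthogonal_idempotents_half id) auto
      moreover have "jp k (jp c w) = jp c (jp k w)" for w
        using orth[of k c] k False by (intro orthogonal_idempotents_commute id) auto
      ultimately show ?thesis
        using False \<open>c = d\<close> p by (simp add: jp_bilinear)
    qed
  next
    case False
    then have cd: "jp c d = 0" "jp d c = 0"
      using orth k by auto
    have p: "polar_rep c d z = 2 *\<^sub>R jp c (jp d z)" "polar_rep c d z = 2 *\<^sub>R jp d (jp c z)"
      using cd orthogonal_idempotents_commute[OF id(2) cd(1)]
      by (simp_all add: polar_rep_def scaleR_2 jp_bilinear)
    consider "k = c" | "k = d" | "k \<noteq> c" "k \<noteq> d" by blast
    then show ?thesis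
    proof cases
      case 1
      then show ?thesis
        using orthogonal_idempotents_half[OF id(2) cd(1), of z] False
        by (simp add: p(1) jp_bilinear)
    next
      case 2
      then show ?thesis
        using orthogonal_idempotents_half[OF id(3) cd(2), of z] False
        by (simp add: p(2) jp_bilinear)
    next
      case 3
      then show ?thesis
        using orthogonal_idempotents_triple[OF id(1,2) orth[OF k(1,2)] orth[OF k(1,3)] cd(1), of z]
        by (simp add: p(1) jp_bilinear)
    qed
  qed
qed

lemma jp_sum_polar_rep:
  assumes C: "orthogonal_idempotents C" and k: "c \<in> C" "d \<in> C"
  shows "jp (\<Sum>k\<in>C. g k *\<^sub>R k) (polar_rep c d z) = ((g c + g d) / 2) *\<^sub>R polar_rep c d z"
proof -
  have fin: "finite C"
    using C by (simp add: orthogonal_idempotents_def)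
  have "jp (\<Sum>k\<in>C. g k *\<^sub>R k) (polar_rep c d z) = (\<Sum>k\<in>C. g k *\<^sub>R jp k (polar_rep c d z))"
    by (simp add: jp_sum_left jp_bilinear)
  also have "\<dots> = (\<Sum>k\<in>C. (if k = c then g k / 2 else 0) + (if k = d then g k / 2 else 0)) *\<^sub>R
      polar_rep c d z"
    unfolding scaleR_sum_left
    by (intro sum.cong) (simp_all add: jp_polar_rep[OF C _ k])
  also have "(\<Sum>k\<in>C. (if k = c then g k / 2 else 0) + (if k = d then g k / 2 else 0))
      = (g c + g d) / 2"
    using fin k by (simp add: sum.distrib add_divide_distrib)
  finally show ?thesis .
qed

lemma quadratic_rep_polar_rep:
  assumes C: "orthogonal_idempotents C" and k: "c \<in> C" "d \<in> C"
  shows "quadratic_rep jp (\<Sum>k\<in>C. g k *\<^sub>R k) (polar_rep c d z) = (g c * g d) *\<^sub>R polar_rep c d z"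
proof -
  \<comment> \<open>On this component \<open>L(x)\<close> acts as the mean of \<open>g c\<close> and
    \<open>g d\<close>, and \<open>L(x^2)\<close> as the mean of their squares.\<close>
  have "2 * ((g c + g d) / 2 * ((g c + g d) / 2)) - (g c * g c + g d * g d) / 2 = g c * g d"
    by (simp add: field_simps)
  then show ?thesis
    unfolding quadratic_rep_def jp_orthogonal_idempotents_sums[OF C] jp_sum_polar_rep[OF C k]
      jp_scaleR_right scaleR_scaleR scaleR_diff_left[symmetric]
    by simp
qed

lemma linear_quadratic_rep: "linear (quadratic_rep jp g)"
  by (rule linearI) (simp_all add: quadratic_rep_def jp_bilinear algebra_simps)

text \<open>This is \<open>P(e) z = z\<close>, expanded along \<open>e = \<Sum>C\<close>.\<close>

lemma sum_polar_rep: "(\<Sum>c\<in>C. \<Sum>d\<in>C. polar_rep c d z) = z" if "\<Sum>C = e"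
  using quadratic_rep_sum[of "\<lambda>_. 1" C z] that
  by (simp add: quadratic_rep_def jp_identity scaleR_2)

text \<open>\<open>P\<close> multiplies the component of \<open>c\<close>, \<open>d\<close> by
  \<open>g c * g d\<close>, so reciprocal coefficients undo it.\<close>

lemma quadratic_rep_inverse:
  assumes C: "orthogonal_idempotents C" "\<Sum>C = e" and gh: "\<And>c. c \<in> C \<Longrightarrow> g c * h c = 1"
  shows "quadratic_rep jp (\<Sum>c\<in>C. g c *\<^sub>R c) (quadratic_rep jp (\<Sum>c\<in>C. h c *\<^sub>R c) z) = z"
proof -
  have "quadratic_rep jp (\<Sum>c\<in>C. g c *\<^sub>R c) (quadratic_rep jp (\<Sum>c\<in>C. h c *\<^sub>R c) z)
      = (\<Sum>c\<in>C. \<Sum>d\<in>C. (h c * h d) *\<^sub>R (g c * g d) *\<^sub>R polar_rep c d z)"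
    unfolding quadratic_rep_sum[of h] linear_sum[OF linear_quadratic_rep]
      linear_scale[OF linear_quadratic_rep]
    by (intro sum.cong) (simp_all add: quadratic_rep_polar_rep[OF C(1)])
  also have "\<dots> = (\<Sum>c\<in>C. \<Sum>d\<in>C. polar_rep c d z)"
  proof (intro sum.cong refl)
    fix c d assume "c \<in> C" "d \<in> C"
    then have "(h c * h d) * (g c * g d) = 1"
      using gh[of c] gh[of d] by (metis mult.assoc mult.commute mult_1)
    then show "(h c * h d) *\<^sub>R (g c * g d) *\<^sub>R polar_rep c d z = polar_rep c d z"
      by simp
  qed
  finally show ?thesis
    by (simp add: sum_polar_rep[OF C(2)])
qed

text \<open>\<open>P(exp (t a)) z\<close> is the solution \<open>u\<close> of \<open>u' = 2 a u\<close> with \<open>u(0) = z\<close>.\<close>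

lemma quadratic_rep_squares:
  assumes C: "orthogonal_idempotents C" "\<Sum>C = e" and g: "\<And>c. c \<in> C \<Longrightarrow> 0 < g c"
    and z: "z \<in> squares"
  shows "quadratic_rep jp (\<Sum>c\<in>C. g c *\<^sub>R c) z \<in> squares"
proof -
  \<comment> \<open>With this choice \<open>exp (\<alpha> c + \<alpha> d) = g c * g d\<close>, so
    the flow reaches the desired map at time 1.\<close>
  define \<alpha> where "\<alpha> c = ln (g c)" for c
  define a where "a = (\<Sum>c\<in>C. \<alpha> c *\<^sub>R c)"
  define u where "u t = (\<Sum>c\<in>C. \<Sum>d\<in>C. exp (t * (\<alpha> c + \<alpha> d)) *\<^sub>R polar_rep c d z)" for t
  have u: "(u has_vector_derivative 2 *\<^sub>R jp a (u t)) (at t)" for t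
  proof -
    have "((\<lambda>t. exp (t * r) *\<^sub>R w) has_vector_derivative (exp (t * r) * r) *\<^sub>R w) (at t)"
      for r and w :: 'a
    proof -
      have "((\<lambda>t. exp (t * r)) has_vector_derivative exp (t * r) * r) (at t)"
        unfolding has_real_derivative_iff_has_vector_derivative[symmetric]
        by (auto intro!: derivative_eq_intros)
      then show ?thesis
        by (rule bounded_linear.has_vector_derivative[OF bounded_linear_scaleR_left])
    qed
    then have "(u has_vector_derivative (\<Sum>c\<in>C. \<Sum>d\<in>C.
        (exp (t * (\<alpha> c + \<alpha> d)) * (\<alpha> c + \<alpha> d)) *\<^sub>R polar_rep c d z)) (at t)"
      unfolding u_def by (intro has_vector_derivative_sum)
    also have "(\<Sum>c\<in>C. \<Sum>d\<in>C. (exp (t * (\<alpha> c + \<alpha> d)) * (\<alpha> c + \<alpha> d)) *\<^sub>R polar_rep c d z)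
        = 2 *\<^sub>R jp a (u t)"
      unfolding u_def jp_sum_right scaleR_sum_right a_def
      by (intro sum.cong) (simp_all add: jp_scaleR_right jp_sum_polar_rep[OF C(1)])
    finally show ?thesis .
  qed
  have "u 0 \<in> squares"
    using z by (simp add: u_def sum_polar_rep[OF C(2)])
  then have "u 1 \<in> squares"
    using flow_squares[OF u, of 1] by simp
  also have "u 1 = quadratic_rep jp (\<Sum>c\<in>C. g c *\<^sub>R c) z"
    unfolding u_def quadratic_rep_sum
    by (intro sum.cong) (simp_all add: \<alpha>_def exp_add g)
  finally show ?thesis .
qed

lemma quadratic_rep_jordan_powr:
  assumes y: "y \<in> symmetric_cone jp"
  shows "quadratic_rep jp (jordan_powr jp e y (-1/2)) y = e"
    and "quadratic_rep jp (jordan_powr jp e y (-1/2)) z \<in> squares \<longleftrightarrow> z \<in> squares"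
proof -
  obtain C l where C: "spectral_decomposition jp e y C l"
    using spectral_decomposition_exists .
  note D = spectral_decompositionD[OF C]
  have pos: "0 < l c" if "c \<in> C" for c
    using symmetric_cone_eigenvalues_pos[OF y C that] .
  \<comment> \<open>\<open>h\<close> gives the coefficients of the square root of \<open>y\<close>;
    its \<open>P\<close> inverts that of \<open>g\<close> and also preserves squares, which yields
    the converse implication.\<close>
  define g h where "g c = l c powr (-1/2)" and "h c = l c powr (1/2)" for c
  have gh: "g c * h c = 1" "h c * g c = 1" "g c > 0" "h c > 0" if "c \<in> C" for c
    using pos[OF that] by (auto simp: g_def h_def powr_add[symmetric])
  have g: "g c * g c * l c = 1" if "c \<in> C" for c
  proof -
    have "g c * g c = l c powr (-1)"
      by (simp add: g_def powr_add[symmetric])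
    then show ?thesis
      using pos[OF that] by (simp add: powr_minus)
  qed
  have G: "jordan_powr jp e y (-1/2) = (\<Sum>c\<in>C. g c *\<^sub>R c)"
    unfolding jordan_powr_eq[OF C] g_def by simp
  have "quadratic_rep jp (jordan_powr jp e y (-1/2)) y
      = 2 *\<^sub>R (\<Sum>c\<in>C. (g c * (g c * l c)) *\<^sub>R c) - (\<Sum>c\<in>C. (g c * g c * l c) *\<^sub>R c)"
    unfolding quadratic_rep_def G
    by (subst (1 2) D(3)) (simp only: jp_orthogonal_idempotents_sums[OF D(1)])
  also have "\<dots> = 2 *\<^sub>R \<Sum>C - \<Sum>C"
    by (simp add: g mult.assoc[symmetric] cong: sum.cong)
  finally show "quadratic_rep jp (jordan_powr jp e y (-1/2)) y = e"
    using D(2) by (simp add: scaleR_2)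
  show "quadratic_rep jp (jordan_powr jp e y (-1/2)) z \<in> squares \<longleftrightarrow> z \<in> squares"
  proof
    show "quadratic_rep jp (jordan_powr jp e y (-1/2)) z \<in> squares" if "z \<in> squares"
      unfolding G using quadratic_rep_squares[OF D(1,2) _ that] gh(3) by blast
    assume "quadratic_rep jp (jordan_powr jp e y (-1/2)) z \<in> squares"
    then have "quadratic_rep jp (\<Sum>c\<in>C. h c *\<^sub>R c)
        (quadratic_rep jp (\<Sum>c\<in>C. g c *\<^sub>R c) z) \<in> squares"
      unfolding G using quadratic_rep_squares[OF D(1,2)] gh(4) by blast
    then show "z \<in> squares"
      using quadratic_rep_inverse[OF D(1,2), of h g z] gh(2) by simp
  qed
qed

subsection \<open>The Hilbert metric\<close>

lemma cone_le_iff_lambda_M: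
  assumes "y \<in> symmetric_cone jp"
  shows "cone_le jp x (t *\<^sub>R y) \<longleftrightarrow> lambda_M jp e x y \<le> t"
proof -
  define P where "P = quadratic_rep jp (jordan_powr jp e y (-1/2))"
  obtain C l where C: "spectral_decomposition jp e (P x) C l"
    using spectral_decomposition_exists .
  have "cone_le jp x (t *\<^sub>R y) \<longleftrightarrow> P (t *\<^sub>R y - x) \<in> squares"
    unfolding cone_le_iff P_def quadratic_rep_jordan_powr(2)[OF assms] ..
  also have "P (t *\<^sub>R y - x) = t *\<^sub>R e - P x"
    unfolding P_def linear_diff[OF linear_quadratic_rep] linear_scale[OF linear_quadratic_rep]
      quadratic_rep_jordan_powr(1)[OF assms] ..
  finally show ?thesis
    unfolding lambda_M_def P_def[symmetric] mem_squares_identity_diff(1)[OF C] .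
qed

lemma cone_le_iff_lambda_m:
  assumes "y \<in> symmetric_cone jp"
  shows "cone_le jp (t *\<^sub>R y) x \<longleftrightarrow> t \<le> lambda_m jp e x y"
proof -
  define P where "P = quadratic_rep jp (jordan_powr jp e y (-1/2))"
  obtain C l where C: "spectral_decomposition jp e (P x) C l"
    using spectral_decomposition_exists .
  have "cone_le jp (t *\<^sub>R y) x \<longleftrightarrow> P (x - t *\<^sub>R y) \<in> squares"
    unfolding cone_le_iff P_def quadratic_rep_jordan_powr(2)[OF assms] ..
  also have "P (x - t *\<^sub>R y) = P x - t *\<^sub>R e"
    unfolding P_def linear_diff[OF linear_quadratic_rep] linear_scale[OF linear_quadratic_rep]
      quadratic_rep_jordan_powr(1)[OF assms] ..
  finally show ?thesis
    unfolding lambda_m_def P_def[symmetric] mem_squares_identity_diff(2)[OF C] .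
qed

lemma hilbert_M_eq:
  assumes "y \<in> symmetric_cone jp"
  shows "hilbert_M jp x y = lambda_M jp e x y"
proof -
  have "{t. cone_le jp x (t *\<^sub>R y)} = {lambda_M jp e x y..}"
    by (auto simp: cone_le_iff_lambda_M[OF assms])
  then show ?thesis
    by (simp add: hilbert_M_def)
qed

lemma hilbert_m_eq:
  assumes "y \<in> symmetric_cone jp"
  shows "hilbert_m jp x y = lambda_m jp e x y"
proof -
  have "{t. cone_le jp (t *\<^sub>R y) x} = {..lambda_m jp e x y}"
    by (auto simp: cone_le_iff_lambda_m[OF assms])
  then show ?thesis
    by (simp add: hilbert_m_def)
qed

text \<open>An interior point \<open>x\<close> leaves room to subtract a positive multiple of
  \<open>y\<close>.\<close>

lemma lambda_m_pos:
  assumes "x \<in> symmetric_cone jp" "y \<in> symmetric_cone jp"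
  shows "0 < lambda_m jp e x y"
proof -
  obtain \<delta> where "\<delta> > 0" "x - \<delta> *\<^sub>R y \<in> squares"
    using assms(1) interior_squaresD unfolding symmetric_cone_eq by blast
  then show ?thesis
    using cone_le_iff_lambda_m[OF assms(2), of \<delta> x] by (simp add: cone_le_iff)
qed

lemma cone_le_scaleR_inverse:
  assumes "t > 0"
  shows "cone_le jp y (t *\<^sub>R x) \<longleftrightarrow> cone_le jp (inverse t *\<^sub>R y) x"
proof -
  have "t *\<^sub>R x - y = t *\<^sub>R (x - inverse t *\<^sub>R y)" "x - inverse t *\<^sub>R y = inverse t *\<^sub>R (t *\<^sub>R x - y)"
    using assms by (simp_all add: scaleR_diff_right)
  then show ?thesis
    using assms squares_scaleR[of t "x - inverse t *\<^sub>R y"] squares_scaleR[of "inverse t" "t *\<^sub>R x - y"]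
    unfolding cone_le_iff by auto
qed

lemma lambda_M_swap:
  assumes x: "x \<in> symmetric_cone jp" and y: "y \<in> symmetric_cone jp"
  shows "lambda_M jp e y x = inverse (lambda_m jp e x y)"
proof (rule antisym)
  note m = lambda_m_pos[OF x y]
  have *: "lambda_M jp e y x \<le> t \<longleftrightarrow> inverse t \<le> lambda_m jp e x y" if "t > 0" for t
    using cone_le_scaleR_inverse[OF that, of y x]
    by (simp add: cone_le_iff_lambda_M[OF x] cone_le_iff_lambda_m[OF y])
  show "lambda_M jp e y x \<le> inverse (lambda_m jp e x y)"
    using m by (subst *) auto
  show "inverse (lambda_m jp e x y) \<le> lambda_M jp e y x"
  proof (rule ccontr)
    \<comment> \<open>The equivalence \<open>*\<close> needs a positive \<open>t\<close>; the
      maximum with \<open>s / 2\<close> ensures this without knowing the sign of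
      \<open>lambda_M jp e y x\<close>, and \<open>t\<close> stays below \<open>s\<close>.\<close>
    define s t where "s = inverse (lambda_m jp e x y)" and "t = max (lambda_M jp e y x) (s / 2)"
    assume "\<not> inverse (lambda_m jp e x y) \<le> lambda_M jp e y x"
    then have "t < s" "0 < t" "lambda_M jp e y x \<le> t"
      using m unfolding t_def s_def less_max_iff_disj by auto
    then have "inverse t \<le> inverse s"
      using * by (simp add: s_def)
    then show False
      using \<open>t < s\<close> \<open>0 < t\<close> inverse_le_imp_le not_le by blast
  qed
qed

end

theorem proposition3p3:
  fixes jp :: "'a::euclidean_space \<Rightarrow> 'a \<Rightarrow> 'a" and e x y :: 'a
  assumes "simple_euclidean_jordan_algebra jp e"
    and "x \<in> symmetric_cone jp" and "y \<in> symmetric_cone jp"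
  shows "hilbert_metric jp x y = ln (lambda_M jp e x y / lambda_m jp e x y)
    \<and> ln (lambda_M jp e x y / lambda_m jp e x y) = ln (lambda_M jp e x y * lambda_M jp e y x)"
proof -
  interpret simple_euclidean_jordan_algebra jp e
    by (fact assms(1))
  show ?thesis
    using assms(2,3)
    by (simp add: hilbert_metric_def hilbert_M_eq hilbert_m_eq lambda_M_swap divide_inverse)
qed

end
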